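(* Let $r,s$ be positive integers with $r+s=n$. Let $\{\theta_k\}_{k\ge1}$ be a sequence of $n\times n$ matrices over $\mathbb{C}$ satisfying $\sum_{k\ge1}\|\theta_k-\theta\|<\infty$, where $\theta$ is a diagonal (or antidiagonal) matrix with all diagonal (or antidiagonal) elements of absolute value $1$. Then the matrix $$F:=\lim_{k\to\infty}\theta^{-k}\theta_k\theta_{k-1}\cdots\theta_2\theta_1$$ exists. Suppose further that the bottom right $s\times s$ submatrix of $F$ is nonsingular. If $\theta$ is diagonal, then the $(r,s)$-matrix continued fraction with approximants $s_k=f(\theta_k\theta_{k-1}\cdots\theta_1)$ converges to $f(F)$. If $\theta$ is antidiagonal, then the even approximants $s_{2k}$ of this $(r,s)$-matrix continued fraction tend to $f(F)$, while its odd approximants $s_{2k+1}$ tend to $f(AF)$ (assuming $f(AF)$ is defined), where $A$ is the antidiagonal $n\times n$ matrix with $1$s along its antidiagonal.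
   Context: For an $n\times n$ complex matrix $D$ with $n=r+s$, let $B_D$ be the $s\times s$ submatrix formed from the last $s$ rows and last $s$ columns of $D$, and $A_D$ the $s\times r$ submatrix formed from the first $r$ entries of the last $s$ rows of $D$. Then $f(D)=B_D^{-1}A_D$, an $s\times r$ matrix, defined when $B_D$ is invertible. The $(r,s)$-matrix continued fraction associated with $\{\theta_k\}$ is defined by its sequence of approximants $s_k:=f(\theta_k\theta_{k-1}\cdots\theta_2\theta_1)$ (here defined for all sufficiently large relevant $k$). Convergence of $s\times r$ matrices is entrywise; $\|\cdot\|$ is a fixed norm on $n\times n$ complex matrices. *)

theory Defs
  imports Complex_Main "Jordan_Normal_Form.Gauss_Jordan_Elimination"
begin

text \<open>Matrix indices start at 0, so the last \<open>s\<close> rows of a matrix of size \<open>r + s\<close>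
  are those with indices \<open>r, \<dots>, r + s - 1\<close>.\<close>

definition lower_right_block :: "nat \<Rightarrow> nat \<Rightarrow> 'a mat \<Rightarrow> 'a mat" where
  "lower_right_block r s D = mat s s (\<lambda>(i, j). D $$ (r + i, r + j))"

definition lower_left_block :: "nat \<Rightarrow> nat \<Rightarrow> 'a mat \<Rightarrow> 'a mat" where
  "lower_left_block r s D = mat s r (\<lambda>(i, j). D $$ (r + i, j))"

text \<open>Meaningful for invertible arguments only; otherwise \<open>mat_inverse\<close> returns \<open>None\<close>
  and nothing is known about the value.\<close>

definition mat_inv :: "'a :: field mat \<Rightarrow> 'a mat" where
  "mat_inv A = the (mat_inverse A)"

lemma mat_inv:
  fixes A :: "'a :: field mat"
  assumes A: "A \<in> carrier_mat n n" and inv: "invertible_mat A"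
  shows "mat_inv A \<in> carrier_mat n n" "mat_inv A * A = 1\<^sub>m n" "A * mat_inv A = 1\<^sub>m n"
proof -
  from inv obtain B where B: "A * B = 1\<^sub>m (dim_row A)" "B * A = 1\<^sub>m (dim_row B)"
    unfolding invertible_mat_def inverts_mat_def by auto
  have "dim_col (A * B) = n" "dim_col (B * A) = dim_row B"
    using A B by auto
  then have "B \<in> carrier_mat n n"
    using A by auto
  then have "A \<in> Units (ring_mat TYPE('a) n ())"
    using A B unfolding Units_def ring_mat_def by auto
  then obtain C where "mat_inverse A = Some C"
    using mat_inverse(1)[OF A, where b = "()"] by (cases "mat_inverse A") auto
  then show "mat_inv A \<in> carrier_mat n n" "mat_inv A * A = 1\<^sub>m n" "A * mat_inv A = 1\<^sub>m n"
    using mat_inverse(2)[OF A] by (auto simp: mat_inv_def)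
qed

text \<open>The map \<open>f(D) = B\<^sub>D\<^sup>-\<^sup>1 A\<^sub>D\<close> is partial: it is defined at \<open>D\<close> iff \<open>cf_defined r s D\<close>.\<close>

definition cf_defined :: "nat \<Rightarrow> nat \<Rightarrow> complex mat \<Rightarrow> bool" where
  "cf_defined r s D \<longleftrightarrow> invertible_mat (lower_right_block r s D)"

definition cf_map :: "nat \<Rightarrow> nat \<Rightarrow> complex mat \<Rightarrow> complex mat" where
  "cf_map r s D = mat_inv (lower_right_block r s D) * lower_left_block r s D"

text \<open>\<open>left_prod n \<theta> k\<close> is \<open>\<theta>\<^sub>k \<theta>\<^sub>k\<^sub>-\<^sub>1 \<cdots> \<theta>\<^sub>1\<close>; the entry \<open>\<theta> 0\<close> of the sequence is never used.\<close>

fun left_prod :: "nat \<Rightarrow> (nat \<Rightarrow> complex mat) \<Rightarrow> nat \<Rightarrow> complex mat" where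
  "left_prod n \<theta> 0 = 1\<^sub>m n"
| "left_prod n \<theta> (Suc k) = \<theta> (Suc k) * left_prod n \<theta> k"

definition antidiagonal_mat :: "'a :: zero mat \<Rightarrow> bool" where
  "antidiagonal_mat A \<longleftrightarrow>
     (\<forall>i<dim_row A. \<forall>j<dim_col A. i + j + 1 \<noteq> dim_row A \<longrightarrow> A $$ (i, j) = 0)"

definition exchange_mat :: "nat \<Rightarrow> complex mat" where
  "exchange_mat n = mat n n (\<lambda>(i, j). if i + j + 1 = n then 1 else 0)"

definition unimodular_diagonal :: "nat \<Rightarrow> complex mat \<Rightarrow> bool" where
  "unimodular_diagonal n T \<longleftrightarrow>
     T \<in> carrier_mat n n \<and> diagonal_mat T \<and> (\<forall>i<n. cmod (T $$ (i, i)) = 1)"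

definition unimodular_antidiagonal :: "nat \<Rightarrow> complex mat \<Rightarrow> bool" where
  "unimodular_antidiagonal n T \<longleftrightarrow>
     T \<in> carrier_mat n n \<and> antidiagonal_mat T \<and> (\<forall>i<n. cmod (T $$ (i, n - 1 - i)) = 1)"

text \<open>An arbitrary vector space norm; submultiplicativity is not required.\<close>

definition norm_on_mats :: "nat \<Rightarrow> (complex mat \<Rightarrow> real) \<Rightarrow> bool" where
  "norm_on_mats n N \<longleftrightarrow>
     (\<forall>A \<in> carrier_mat n n. 0 \<le> N A \<and> (N A = 0 \<longleftrightarrow> A = 0\<^sub>m n n)) \<and>
     (\<forall>A \<in> carrier_mat n n. \<forall>c. N (c \<cdot>\<^sub>m A) = cmod c * N A) \<and>
     (\<forall>A \<in> carrier_mat n n. \<forall>B \<in> carrier_mat n n. N (A + B) \<le> N A + N B)"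

text \<open>Entrywise convergence. The dimensions need to agree only from some index on, because
  the approximants of a continued fraction may be undefined initially.\<close>

definition mat_tendsto :: "(nat \<Rightarrow> complex mat) \<Rightarrow> complex mat \<Rightarrow> bool" where
  "mat_tendsto X L \<longleftrightarrow>
     (\<forall>\<^sub>F k in sequentially. X k \<in> carrier_mat (dim_row L) (dim_col L)) \<and>
     (\<forall>i<dim_row L. \<forall>j<dim_col L. (\<lambda>k. X k $$ (i, j)) \<longlonglongrightarrow> L $$ (i, j))"

text \<open>The sequence \<open>f(X\<^sub>k)\<close> is defined for all large \<open>k\<close> and converges to \<open>L\<close>.\<close>

definition cf_tendsto :: "nat \<Rightarrow> nat \<Rightarrow> (nat \<Rightarrow> complex mat) \<Rightarrow> complex mat \<Rightarrow> bool" where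
  "cf_tendsto r s X L \<longleftrightarrow>
     (\<forall>\<^sub>F k in sequentially. cf_defined r s (X k)) \<and> mat_tendsto (\<lambda>k. cf_map r s (X k)) L"

end

theory Submission
  imports "HOL-Analysis.Function_Topology" "HOL-Analysis.Topology_Euclidean_Space"
    "Jordan_Normal_Form.Determinant" Defs
begin

text \<open>
  Both \<open>T\<close> and \<open>T\<^sup>-\<^sup>1\<close> have exactly one nonzero entry in each row and column, of modulus 1,
  so multiplying by them on the left only permutes the rows of a matrix and rotates its entries.
  Hence it preserves the sum of the moduli of the entries (\<open>entry_sum\<close>), which is a
  submultiplicative norm. Write \<open>L\<^sub>k\<close> for \<open>\<theta>\<^sub>k \<cdots> \<theta>\<^sub>1\<close> and \<open>P\<^sub>k\<close> for \<open>T\<^sup>-\<^sup>k L\<^sub>k\<close>. Then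
  \<open>P\<^sub>k\<^sub>+\<^sub>1 - P\<^sub>k = T\<^sup>-\<^sup>k\<^sup>-\<^sup>1 (\<theta>\<^sub>k\<^sub>+\<^sub>1 - T) L\<^sub>k\<close>, and \<open>L\<^sub>k\<close> has the same norm as \<open>P\<^sub>k\<close>; the increment
  is therefore at most \<open>e\<^sub>k\<close> times the norm of \<open>P\<^sub>k\<close>, where \<open>e\<^sub>k\<close> is the norm of
  \<open>\<theta>\<^sub>k\<^sub>+\<^sub>1 - T\<close>. As \<open>\<Sum>e\<^sub>k\<close> converges, the \<open>P\<^sub>k\<close> are bounded, by \<open>exp (\<Sum>e\<^sub>k)\<close> times the norm of
  \<open>P\<^sub>0\<close>, and their increments are summable (\<open>untwisted_product_converges\<close>). The summability
  hypothesis is about an arbitrary norm; it transfers to \<open>entry_sum\<close> because all norms on a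
  finite-dimensional space are equivalent (\<open>entry_sum_le_norm_on_mats\<close>).

  The map \<open>f(D) = B\<^sup>-\<^sup>1 A\<close> has two properties that matter. It is continuous where it is defined,
  by Cramer's rule (\<open>cf_tendsto_of_entrywise\<close>). It also does not change when the rows of its
  argument are multiplied by nonzero scalars, since the same invertible diagonal factor enters
  \<open>A\<close> and \<open>B\<close> on the left and cancels (\<open>cf_map_row_scaled\<close>). If \<open>T\<close> is diagonal, then
  \<open>L\<^sub>k = T\<^sup>k P\<^sub>k\<close> is a row scaling of \<open>P\<^sub>k\<close>, so \<open>f(L\<^sub>k) = f(P\<^sub>k)\<close> tends to \<open>f(F)\<close>. If \<open>T\<close> is
  antidiagonal, then \<open>T\<^sup>2\<close> is diagonal and \<open>T\<close> is a diagonal matrix times the exchange matrix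
  \<open>J\<close>. So \<open>L\<^sub>2\<^sub>k\<close> is a row scaling of \<open>P\<^sub>2\<^sub>k\<close>, and \<open>L\<^sub>2\<^sub>k\<^sub>+\<^sub>1\<close> is one of \<open>J P\<^sub>2\<^sub>k\<^sub>+\<^sub>1\<close>.
\<close>

section \<open>Norms on matrices\<close>

definition entry_sum :: "nat \<Rightarrow> complex mat \<Rightarrow> real" where
  "entry_sum n A = (\<Sum>i<n. \<Sum>j<n. cmod (A $$ (i, j)))"

lemma entry_sum_nonneg: "0 \<le> entry_sum n A"
  unfolding entry_sum_def by (intro sum_nonneg norm_ge_zero)

lemma cmod_entry_le_entry_sum:
  assumes "i < n" "j < n"
  shows "cmod (A $$ (i, j)) \<le> entry_sum n A"
proof -
  have "cmod (A $$ (i, j)) \<le> (\<Sum>j<n. cmod (A $$ (i, j)))"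
    using assms by (intro member_le_sum) auto
  also have "\<dots> \<le> entry_sum n A"
    unfolding entry_sum_def
    using assms by (intro member_le_sum[where f = "\<lambda>i. \<Sum>j<n. cmod (A $$ (i, j))"] sum_nonneg) auto
  finally show ?thesis .
qed

lemma index_mult_mat_sum:
  assumes "A \<in> carrier_mat n m" "B \<in> carrier_mat m l" "i < n" "j < l"
  shows "(A * B) $$ (i, j) = (\<Sum>k<m. A $$ (i, k) * B $$ (k, j))"
  using assms by (auto simp: scalar_prod_def lessThan_atLeast0 intro!: sum.cong)

lemma entry_sum_mult:
  assumes A: "A \<in> carrier_mat n n" and B: "B \<in> carrier_mat n n"
  shows "entry_sum n (A * B) \<le> entry_sum n A * entry_sum n B"
proof -
  define b where "b k = (\<Sum>j<n. cmod (B $$ (k, j)))" for k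
  have b: "b k \<le> entry_sum n B" if "k < n" for k
    unfolding entry_sum_def b_def using that
    by (intro member_le_sum[where f = "\<lambda>i. \<Sum>j<n. cmod (B $$ (i, j))"] sum_nonneg) auto
  have "entry_sum n (A * B) \<le> (\<Sum>i<n. \<Sum>j<n. \<Sum>k<n. cmod (A $$ (i, k)) * cmod (B $$ (k, j)))"
    unfolding entry_sum_def
    by (intro sum_mono) (auto simp: index_mult_mat_sum[OF A B] norm_mult intro!: sum_norm_le)
  also have "\<dots> = (\<Sum>i<n. \<Sum>k<n. cmod (A $$ (i, k)) * b k)"
    unfolding b_def sum_distrib_left by (intro sum.cong refl sum.swap)
  also have "\<dots> \<le> (\<Sum>i<n. \<Sum>k<n. cmod (A $$ (i, k)) * entry_sum n B)"
    using b by (intro sum_mono mult_left_mono) auto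
  also have "\<dots> = entry_sum n A * entry_sum n B"
    by (simp add: entry_sum_def sum_distrib_right)
  finally show ?thesis .
qed

text \<open>The triangle inequality applied to the expansion of a matrix in matrix units.\<close>

lemma norm_on_mats_le_weighted_sum:
  assumes N: "norm_on_mats n N"
  shows "N (mat n n z) \<le>
    (\<Sum>p\<in>{..<n} \<times> {..<n}. cmod (z p) * N (mat n n (\<lambda>q. if q = p then 1 else 0)))"
proof -
  define E where "E p = mat n n (\<lambda>q. if q = p then 1 else (0 :: complex))" for p
  define R where "R J = mat n n (\<lambda>q. if q \<in> J then z q else 0)" for J
  have "N (R J) \<le> (\<Sum>p\<in>J. cmod (z p) * N (E p))" if "finite J" for J
    using that
  proof (induction J rule: finite_induct)
    case empty
    have "R {} = 0\<^sub>m n n"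
      by (auto simp: R_def)
    moreover have "N (0\<^sub>m n n) = 0"
      using N zero_carrier_mat[of n n] unfolding norm_on_mats_def by blast
    ultimately show ?case
      by simp
  next
    case (insert p J)
    have E: "E p \<in> carrier_mat n n" and RJ: "R J \<in> carrier_mat n n"
      by (auto simp: E_def R_def)
    have "R (insert p J) = z p \<cdot>\<^sub>m E p + R J"
      using insert.hyps by (intro eq_matI) (auto simp: R_def E_def)
    moreover have "N (z p \<cdot>\<^sub>m E p + R J) \<le> N (z p \<cdot>\<^sub>m E p) + N (R J)"
      using N smult_carrier_mat[OF E, of "z p"] RJ unfolding norm_on_mats_def by blast
    ultimately have "N (R (insert p J)) \<le> N (z p \<cdot>\<^sub>m E p) + N (R J)"
      by simp
    also have "N (z p \<cdot>\<^sub>m E p) = cmod (z p) * N (E p)"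
      using N E unfolding norm_on_mats_def by blast
    finally show ?case
      using insert by simp
  qed
  moreover have "R ({..<n} \<times> {..<n}) = mat n n z"
    by (auto simp: R_def)
  ultimately show ?thesis
    by (metis (no_types, lifting) E_def finite_SigmaI finite_lessThan sum.cong)
qed

lemma norm_on_mats_diff_le:
  assumes N: "norm_on_mats n N" and A: "A \<in> carrier_mat n n" and B: "B \<in> carrier_mat n n"
  shows "\<bar>N A - N B\<bar> \<le> N (A - B)"
proof -
  have "B + (A - B) = A" "A + (- 1) \<cdot>\<^sub>m (A - B) = B"
    using A B by (auto intro!: eq_matI)
  moreover have "N (B + (A - B)) \<le> N B + N (A - B)"
    "N (A + (- 1) \<cdot>\<^sub>m (A - B)) \<le> N A + N ((- 1) \<cdot>\<^sub>m (A - B))"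
    "N ((- 1) \<cdot>\<^sub>m (A - B)) = cmod (- 1) * N (A - B)"
    using N A B unfolding norm_on_mats_def by (meson add_carrier_mat minus_carrier_mat smult_carrier_mat)+
  ultimately show ?thesis
    by simp
qed

lemma continuous_on_norm_on_mats:
  assumes N: "norm_on_mats n N"
  shows "continuous_on UNIV (\<lambda>x. N (mat n n x))"
proof -
  let ?I = "{..<n} \<times> {..<n}"
  define c where "c p = N (mat n n (\<lambda>q. if q = p then 1 else 0))" for p
  have "((\<lambda>x. N (mat n n x)) \<longlongrightarrow> N (mat n n y)) (at y)" for y
  proof -
    have "((\<lambda>x. x p) \<longlongrightarrow> y p) (at y)" for p
      using continuous_on_product_coordinates[of p] unfolding continuous_on_def by blast
    then have "((\<lambda>x. \<Sum>p\<in>?I. cmod (x p - y p) * c p) \<longlongrightarrow> (\<Sum>p\<in>?I. cmod (y p - y p) * c p)) (at y)"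
      by (intro tendsto_intros)
    then have lim: "((\<lambda>x. \<Sum>p\<in>?I. cmod (x p - y p) * c p) \<longlongrightarrow> 0) (at y)"
      by simp
    have "\<bar>N (mat n n x) - N (mat n n y)\<bar> \<le> (\<Sum>p\<in>?I. cmod (x p - y p) * c p)" for x
    proof -
      have "mat n n x - mat n n y = mat n n (\<lambda>p. x p - y p)"
        by (intro eq_matI) auto
      then show ?thesis
        using norm_on_mats_diff_le[OF N, of "mat n n x" "mat n n y"]
          norm_on_mats_le_weighted_sum[OF N, of "\<lambda>p. x p - y p"]
        by (simp add: c_def)
    qed
    then have "((\<lambda>x. N (mat n n x) - N (mat n n y)) \<longlongrightarrow> 0) (at y)"
      by (intro Lim_null_comparison[OF _ lim] always_eventually) auto
    then show ?thesis
      by (rule LIM_zero_cancel)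
  qed
  then show ?thesis
    by (auto simp: continuous_on_def)
qed

text \<open>On the unit sphere of \<open>entry_sum\<close>, which is compact, the continuous function \<open>N\<close> attains
  its minimum. That minimum is positive because \<open>N\<close> is definite, and by homogeneity its reciprocal
  is the required constant.\<close>

lemma entry_sum_le_norm_on_mats:
  assumes N: "norm_on_mats n N"
  obtains c where "\<And>A. A \<in> carrier_mat n n \<Longrightarrow> entry_sum n A \<le> c * N A"
proof -
  let ?I = "{..<n} \<times> {..<n}"
  \<comment> \<open>The sphere is placed in the function space over all index pairs, with value 0 outside the
    \<open>n \<times> n\<close> square, so that it is a closed part of a product of compact sets.\<close>
  define C :: "(nat \<times> nat \<Rightarrow> complex) set"
    where "C = (\<Pi>\<^sub>E p\<in>UNIV. if p \<in> ?I then cball 0 1 else {0})"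
  define K where "K = C \<inter> {x. (\<Sum>p\<in>?I. cmod (x p)) = 1}"
  have sum_I: "entry_sum n (mat n n x) = (\<Sum>p\<in>?I. cmod (x p))" for x
    by (simp add: entry_sum_def sum.cartesian_product)
  have "compactin (product_topology (\<lambda>_. euclidean) UNIV) C"
    unfolding C_def compactin_PiE by auto
  then have "compact C"
    by (simp add: euclidean_product_topology)
  moreover have "closed {x :: nat \<times> nat \<Rightarrow> complex. (\<Sum>p\<in>?I. cmod (x p)) = 1}"
    using continuous_on_product_coordinates[where 'b = complex]
    by (intro closed_Collect_eq continuous_intros) auto
  ultimately have "compact K"
    unfolding K_def by (rule compact_Int_closed)
  have pos: "N (mat n n x) > 0" if "x \<in> K" for x
  proof -
    have "mat n n x \<noteq> 0\<^sub>m n n"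
    proof
      assume "mat n n x = 0\<^sub>m n n"
      then have "entry_sum n (mat n n x) = 0"
        by (simp add: entry_sum_def)
      with that show False
        by (simp add: K_def sum_I)
    qed
    moreover have "0 \<le> N (mat n n x) \<and> (N (mat n n x) = 0 \<longleftrightarrow> mat n n x = 0\<^sub>m n n)"
      using N mat_carrier[of n n x] unfolding norm_on_mats_def by blast
    ultimately show ?thesis
      by linarith
  qed
  obtain m where m: "m > 0" "\<And>x. x \<in> K \<Longrightarrow> m \<le> N (mat n n x)"
    \<comment> \<open>The sphere is empty for \<open>n = 0\<close>.\<close>
  proof (cases "K = {}")
    case True
    then show ?thesis
      using that[of 1] by simp
  next
    case False
    obtain x where "x \<in> K" "\<And>y. y \<in> K \<Longrightarrow> N (mat n n x) \<le> N (mat n n y)"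
      using continuous_attains_inf[OF \<open>compact K\<close> False
          continuous_on_subset[OF continuous_on_norm_on_mats[OF N]]] by auto
    then show ?thesis
      using that[of "N (mat n n x)"] pos by blast
  qed
  have "entry_sum n A \<le> (1 / m) * N A" if A: "A \<in> carrier_mat n n" for A
  proof (cases "entry_sum n A = 0")
    case True
    then show ?thesis
      using m N A by (simp add: norm_on_mats_def)
  next
    case False
    define t where "t = entry_sum n A"
    have t: "t > 0"
      using False entry_sum_nonneg[of n A] by (simp add: t_def)
    define x where "x p = (if p \<in> ?I then A $$ p / t else 0)" for p
    have x: "mat n n x = complex_of_real (1 / t) \<cdot>\<^sub>m A"
      using A by (intro eq_matI) (auto simp: x_def)
    have "(\<Sum>p\<in>?I. cmod (x p)) = entry_sum n A / t"
      unfolding entry_sum_def sum.cartesian_product sum_divide_distrib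
      using t by (intro sum.cong) (auto simp: x_def norm_divide)
    then have "(\<Sum>p\<in>?I. cmod (x p)) = 1"
      using t by (simp add: t_def)
    moreover have "x \<in> C"
      using t cmod_entry_le_entry_sum[of _ n _ A]
      by (auto simp: C_def x_def PiE_def t_def[symmetric] norm_divide)
    ultimately have "m \<le> N (mat n n x)"
      by (intro m(2)) (simp add: K_def)
    also have "\<dots> = N A / t"
      using N A t unfolding x norm_on_mats_def by (simp add: norm_divide)
    finally show ?thesis
      using t m(1) by (simp add: t_def field_simps)
  qed
  then show ?thesis
    by (rule that)
qed

section \<open>Unimodular monomial matrices\<close>

text \<open>The common shape of the diagonal case, where \<open>\<sigma>\<close> is the identity, and the antidiagonal case,
  where \<open>\<sigma>\<close> reverses the indices.\<close>

definition unimodular_monomial :: "nat \<Rightarrow> (nat \<Rightarrow> nat) \<Rightarrow> complex mat \<Rightarrow> bool" where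
  "unimodular_monomial n \<sigma> T \<longleftrightarrow> T \<in> carrier_mat n n \<and> bij_betw \<sigma> {..<n} {..<n} \<and>
     (\<forall>i<n. cmod (T $$ (i, \<sigma> i)) = 1) \<and> (\<forall>i<n. \<forall>j<n. j \<noteq> \<sigma> i \<longrightarrow> T $$ (i, j) = 0)"

lemma unimodular_diagonal_imp_monomial:
  "unimodular_diagonal n T \<Longrightarrow> unimodular_monomial n (\<lambda>i. i) T"
  by (auto simp: unimodular_diagonal_def unimodular_monomial_def diagonal_mat_def
      bij_betw_def inj_on_def)

lemma unimodular_antidiagonal_imp_monomial:
  assumes "unimodular_antidiagonal n T"
  shows "unimodular_monomial n (\<lambda>i. n - 1 - i) T"
proof -
  have "bij_betw (\<lambda>i. n - 1 - i) {..<n} {..<n}"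
    by (rule bij_betw_byWitness[where f' = "\<lambda>i. n - 1 - i"]) auto
  moreover have "T $$ (i, j) = 0" if "i < n" "j < n" "j \<noteq> n - 1 - i" for i j
  proof -
    have "i + j + 1 \<noteq> n"
      using that by linarith
    then show ?thesis
      using assms that by (auto simp: unimodular_antidiagonal_def antidiagonal_mat_def)
  qed
  ultimately show ?thesis
    using assms by (auto simp: unimodular_antidiagonal_def unimodular_monomial_def)
qed

context
  fixes n :: nat and \<sigma> :: "nat \<Rightarrow> nat" and T :: "complex mat"
  assumes T: "unimodular_monomial n \<sigma> T"
begin

lemma monomial_carrier: "T \<in> carrier_mat n n"
  using T by (simp add: unimodular_monomial_def)

lemma monomial_perm_less: "i < n \<Longrightarrow> \<sigma> i < n"
  using T by (auto simp: unimodular_monomial_def bij_betw_def)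

lemma monomial_mult_index:
  assumes X: "X \<in> carrier_mat n m" and ij: "i < n" "j < m"
  shows "(T * X) $$ (i, j) = T $$ (i, \<sigma> i) * X $$ (\<sigma> i, j)"
proof -
  have "(T * X) $$ (i, j) = (\<Sum>k<n. T $$ (i, k) * X $$ (k, j))"
    by (rule index_mult_mat_sum[OF monomial_carrier X ij])
  also have "\<dots> = (\<Sum>k<n. if k = \<sigma> i then T $$ (i, k) * X $$ (k, j) else 0)"
    using T ij by (intro sum.cong) (auto simp: unimodular_monomial_def)
  also have "\<dots> = T $$ (i, \<sigma> i) * X $$ (\<sigma> i, j)"
    using monomial_perm_less[OF ij(1)] by simp
  finally show ?thesis .
qed

lemma monomial_invertible: "invertible_mat T"
proof -
  define S where "S = mat n n (\<lambda>(i, j). if i = \<sigma> j then 1 / T $$ (j, \<sigma> j) else 0)"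
  have S: "S \<in> carrier_mat n n"
    by (simp add: S_def)
  have nz: "T $$ (i, \<sigma> i) \<noteq> 0" if "i < n" for i
    using T that by (auto simp: unimodular_monomial_def)
  have inj: "inj_on \<sigma> {..<n}"
    using T by (simp add: unimodular_monomial_def bij_betw_def)
  have "T * S = 1\<^sub>m n"
  proof (rule eq_matI)
    fix i j assume "i < dim_row (1\<^sub>m n)" "j < dim_col (1\<^sub>m n)"
    then have ij: "i < n" "j < n"
      by auto
    then show "(T * S) $$ (i, j) = 1\<^sub>m n $$ (i, j)"
      using monomial_perm_less nz inj_onD[OF inj, of i j]
      unfolding monomial_mult_index[OF S ij] by (auto simp: S_def)
  qed (use S monomial_carrier in auto)
  moreover from this have "S * T = 1\<^sub>m n"
    by (rule mat_mult_left_right_inverse[OF monomial_carrier S])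
  ultimately show ?thesis
    using S monomial_carrier unfolding invertible_mat_def inverts_mat_def by auto
qed

lemmas mat_inv_monomial = mat_inv[OF monomial_carrier monomial_invertible]

text \<open>Row \<open>i\<close> of \<open>T * X\<close> is row \<open>\<sigma> i\<close> of \<open>X\<close> times a scalar of modulus 1, so the moduli of the
  entries are merely rearranged.\<close>

lemma entry_sum_monomial_mult:
  assumes X: "X \<in> carrier_mat n n"
  shows "entry_sum n (T * X) = entry_sum n X"
proof -
  have "entry_sum n (T * X) = (\<Sum>i<n. \<Sum>j<n. cmod (X $$ (\<sigma> i, j)))"
    unfolding entry_sum_def using T
    by (intro sum.cong refl) (auto simp: monomial_mult_index[OF X] norm_mult unimodular_monomial_def)
  also have "\<dots> = entry_sum n X"
    unfolding entry_sum_def using T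
    by (intro sum.reindex_bij_betw) (simp add: unimodular_monomial_def)
  finally show ?thesis .
qed

lemma entry_sum_mat_inv_pow_mult:
  assumes X: "X \<in> carrier_mat n n"
  shows "entry_sum n (mat_inv T ^\<^sub>m k * X) = entry_sum n X"
  using X
proof (induction k arbitrary: X)
  case 0
  then show ?case
    using mat_inv_monomial by simp
next
  case (Suc k)
  let ?S = "mat_inv T"
  have SX: "?S * X \<in> carrier_mat n n"
    using mat_inv_monomial Suc.prems by auto
  have "?S ^\<^sub>m Suc k * X = ?S ^\<^sub>m k * (?S * X)"
    using mat_inv_monomial(1) Suc.prems by (simp add: assoc_mult_mat[of _ n n _ n _ n])
  then have "entry_sum n (?S ^\<^sub>m Suc k * X) = entry_sum n (T * (?S * X))"
    using Suc.IH[OF SX] entry_sum_monomial_mult[OF SX] by simp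
  also have "T * (?S * X) = X"
    using mat_inv_monomial monomial_carrier Suc.prems
    by (simp add: assoc_mult_mat[of T n n ?S n X n, symmetric])
  finally show ?case .
qed

lemma monomial_pow_mat_inv_pow: "T ^\<^sub>m k * mat_inv T ^\<^sub>m k = 1\<^sub>m n"
proof (induction k)
  case 0
  then show ?case
    using mat_inv_monomial monomial_carrier by auto
next
  case (Suc k)
  let ?S = "mat_inv T"
  note c = monomial_carrier mat_inv_monomial(1)
    pow_carrier_mat[OF monomial_carrier] pow_carrier_mat[OF mat_inv_monomial(1)]
  have comm: "?S ^\<^sub>m k * ?S = ?S * ?S ^\<^sub>m k"
  proof (induction k)
    case (Suc k)
    have Sk: "?S ^\<^sub>m k \<in> carrier_mat n n"
      using c by simp
    have "?S ^\<^sub>m Suc k * ?S = ?S * ?S ^\<^sub>m k * ?S"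
      by (simp add: Suc)
    also have "\<dots> = ?S * ?S ^\<^sub>m Suc k"
      using assoc_mult_mat[OF c(2) Sk c(2)] by simp
    finally show ?case .
  qed (use c in auto)
  have "T ^\<^sub>m Suc k * ?S ^\<^sub>m Suc k = T ^\<^sub>m k * T * (?S * ?S ^\<^sub>m k)"
    by (simp add: comm)
  also have "\<dots> = T ^\<^sub>m k * (T * ?S * ?S ^\<^sub>m k)"
    using c by (simp add: assoc_mult_mat[of _ n n _ n _ n])
  also have "\<dots> = T ^\<^sub>m k * ?S ^\<^sub>m k"
    using c mat_inv_monomial by auto
  finally show ?case
    using Suc by simp
qed

end

section \<open>Existence of the limit\<close>

lemma left_prod_carrier:
  assumes "\<And>k. k \<ge> 1 \<Longrightarrow> \<theta> k \<in> carrier_mat n n"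
  shows "left_prod n \<theta> k \<in> carrier_mat n n"
  by (induction k) (use assms in \<open>auto intro: mult_carrier_mat\<close>)

text \<open>The powers of \<open>T\<^sup>-\<^sup>1\<close> act from the left as isometries of \<open>entry_sum\<close>. They can therefore
  be dropped from the size of an increment, and \<open>P\<^sub>k\<close> is as large as the product that it untwists.
  This leaves the recursive estimate of an infinite product \<open>\<Prod>(1 + e\<^sub>k)\<close> with \<open>\<Sum>e\<^sub>k < \<infinity>\<close>.\<close>

lemma untwisted_product_converges:
  assumes mono: "unimodular_monomial n \<sigma> T"
    and th: "\<And>k. k \<ge> 1 \<Longrightarrow> \<theta> k \<in> carrier_mat n n"
    and summ: "summable (\<lambda>k. entry_sum n (\<theta> (Suc k) - T))"
  shows "\<exists>F. mat_tendsto (\<lambda>k. mat_inv T ^\<^sub>m k * left_prod n \<theta> k) F"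
proof -
  note Tc = monomial_carrier[OF mono] and inv = mat_inv_monomial[OF mono]
    and isometry = entry_sum_mat_inv_pow_mult[OF mono]
  let ?S = "mat_inv T"
  define L where "L = left_prod n \<theta>"
  define P where "P k = ?S ^\<^sub>m k * L k" for k
  define e where "e k = entry_sum n (\<theta> (Suc k) - T)" for k
  have e: "e k \<ge> 0" for k
    by (simp add: e_def entry_sum_nonneg)
  have Sk: "?S ^\<^sub>m k \<in> carrier_mat n n" for k
    using inv(1) by auto
  have L: "L k \<in> carrier_mat n n" for k
    unfolding L_def by (rule left_prod_carrier[OF th])
  have P: "P k \<in> carrier_mat n n" for k
    unfolding P_def by (rule mult_carrier_mat[OF Sk L])
  have D: "\<theta> (Suc k) - T \<in> carrier_mat n n" for k
    using Tc by (rule minus_carrier_mat)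
  have increment: "P (Suc k) - P k = ?S ^\<^sub>m Suc k * ((\<theta> (Suc k) - T) * L k)" for k
  proof -
    have thk: "\<theta> (Suc k) \<in> carrier_mat n n"
      using th by simp
    \<comment> \<open>One factor of \<open>T\<^sup>-\<^sup>1\<close> cancels \<open>T\<close>, which makes \<open>P k\<close> the \<open>T\<close>-part of \<open>P (Suc k)\<close>.\<close>
    have "?S ^\<^sub>m Suc k * (T * L k) = ?S ^\<^sub>m k * (?S * T) * L k"
      using Sk[of k] inv(1) Tc L[of k]
      by (simp add: assoc_mult_mat[of _ n n _ n _ n])
    then have "?S ^\<^sub>m Suc k * (T * L k) = P k"
      using Sk[of k] inv by (simp add: P_def)
    moreover have "(\<theta> (Suc k) - T) * L k = \<theta> (Suc k) * L k - T * L k"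
      using thk Tc L by (rule minus_mult_distrib_mat)
    moreover have "?S ^\<^sub>m Suc k * (\<theta> (Suc k) * L k - T * L k)
        = ?S ^\<^sub>m Suc k * (\<theta> (Suc k) * L k) - ?S ^\<^sub>m Suc k * (T * L k)"
      using Sk[of "Suc k"] thk Tc L[of k] by (intro mult_minus_distrib_mat) auto
    ultimately show ?thesis
      by (simp add: P_def L_def)
  qed
  have step: "entry_sum n (P (Suc k) - P k) \<le> e k * entry_sum n (P k)" for k
  proof -
    have "entry_sum n (P (Suc k) - P k) = entry_sum n ((\<theta> (Suc k) - T) * L k)"
      unfolding increment by (rule isometry[OF mult_carrier_mat[OF D L]])
    also have "\<dots> \<le> e k * entry_sum n (L k)"
      unfolding e_def using D L by (rule entry_sum_mult)
    also have "entry_sum n (L k) = entry_sum n (P k)"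
      unfolding P_def by (rule isometry[OF L, symmetric])
    finally show ?thesis .
  qed
  have growth: "entry_sum n (P (Suc k)) \<le> exp (e k) * entry_sum n (P k)" for k
  proof -
    have "entry_sum n (P (Suc k)) \<le> entry_sum n (P k) + entry_sum n (P (Suc k) - P k)"
      unfolding entry_sum_def sum.distrib[symmetric]
    proof (intro sum_mono)
      fix i j assume "i \<in> {..<n}" "j \<in> {..<n}"
      then have "(P (Suc k) - P k) $$ (i, j) = P (Suc k) $$ (i, j) - P k $$ (i, j)"
        using P[of k] P[of "Suc k"] by auto
      then show "cmod (P (Suc k) $$ (i, j))
          \<le> cmod (P k $$ (i, j)) + cmod ((P (Suc k) - P k) $$ (i, j))"
        using norm_triangle_sub[of "P (Suc k) $$ (i, j)" "P k $$ (i, j)"] by simp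
    qed
    also have "\<dots> \<le> (1 + e k) * entry_sum n (P k)"
      using step[of k] by (simp add: algebra_simps)
    also have "\<dots> \<le> exp (e k) * entry_sum n (P k)"
      by (intro mult_right_mono exp_ge_add_one_self entry_sum_nonneg)
    finally show ?thesis .
  qed
  define M where "M = exp (suminf e) * entry_sum n (P 0)"
  have bound: "entry_sum n (P k) \<le> M" for k
  proof -
    have "entry_sum n (P k) \<le> exp (\<Sum>i<k. e i) * entry_sum n (P 0)"
    proof (induction k)
      case (Suc k)
      have "entry_sum n (P (Suc k)) \<le> exp (e k) * (exp (\<Sum>i<k. e i) * entry_sum n (P 0))"
        using growth[of k] Suc by (meson exp_ge_zero mult_left_mono order_trans)
      then show ?case
        by (simp add: exp_add mult_ac)
    qed simp
    also have "\<dots> \<le> M"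
      unfolding M_def using summ e
      by (intro mult_right_mono entry_sum_nonneg) (auto simp: e_def[abs_def] intro: sum_le_suminf)
    finally show ?thesis .
  qed
  have "convergent (\<lambda>k. P k $$ (i, j))" if ij: "i < n" "j < n" for i j
  proof -
    have "cmod (P (Suc k) $$ (i, j) - P k $$ (i, j)) \<le> e k * M" for k
    proof -
      have "P (Suc k) $$ (i, j) - P k $$ (i, j) = (P (Suc k) - P k) $$ (i, j)"
        using ij P[of k] P[of "Suc k"] by auto
      then have "cmod (P (Suc k) $$ (i, j) - P k $$ (i, j)) \<le> e k * entry_sum n (P k)"
        using cmod_entry_le_entry_sum[OF ij, of "P (Suc k) - P k"] step[of k] by simp
      also have "\<dots> \<le> e k * M"
        using bound e by (intro mult_left_mono)
      finally show ?thesis .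
    qed
    moreover have "summable (\<lambda>k. e k * M)"
      unfolding e_def by (rule summable_mult2[OF summ])
    ultimately have "summable (\<lambda>k. P (Suc k) $$ (i, j) - P k $$ (i, j))"
      by (rule summable_comparison_test'[rotated])
    then have "convergent (\<lambda>k. P k $$ (i, j) - P 0 $$ (i, j))"
      unfolding summable_iff_convergent
      by (simp add: sum_lessThan_telescope[of "\<lambda>k. P k $$ (i, j)"])
    then have "convergent (\<lambda>k. P k $$ (i, j) - P 0 $$ (i, j) + P 0 $$ (i, j))"
      by (intro convergent_add convergent_const)
    then show ?thesis
      by simp
  qed
  then have "(\<lambda>k. P k $$ (i, j)) \<longlonglongrightarrow> mat n n (\<lambda>(i, j). lim (\<lambda>k. P k $$ (i, j))) $$ (i, j)"
    if "i < n" "j < n" for i j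
    using that by (simp add: convergent_LIMSEQ_iff)
  then have "mat_tendsto P (mat n n (\<lambda>(i, j). lim (\<lambda>k. P k $$ (i, j))))"
    using P by (simp add: mat_tendsto_def)
  then show ?thesis
    unfolding P_def L_def by blast
qed

section \<open>Continuity of the continued fraction map\<close>

lemma invertible_mat_iff_det_nonzero:
  fixes B :: "'a :: field mat"
  assumes B: "B \<in> carrier_mat m m"
  shows "invertible_mat B \<longleftrightarrow> det B \<noteq> 0"
proof
  assume "invertible_mat B"
  from mat_inv[OF B this] have "det B * det (mat_inv B) = 1"
    using det_mult[OF B, of "mat_inv B"] by simp
  then show "det B \<noteq> 0"
    by auto
next
  assume nz: "det B \<noteq> 0"
  define C where "C = (1 / det B) \<cdot>\<^sub>m adj_mat B"
  have "B * C = 1\<^sub>m m" "C * B = 1\<^sub>m m" "C \<in> carrier_mat m m"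
    using adj_mat[OF B] B nz unfolding C_def
    by (auto simp: mult_smult_distrib[OF B] mult_smult_assoc_mat[OF _ B] intro!: eq_matI)
  then show "invertible_mat B"
    using B unfolding invertible_mat_def inverts_mat_def by auto
qed

text \<open>Cramer's rule. It presents the entries of the inverse as quotients of polynomials in the
  entries of \<open>B\<close>, from which continuity is immediate.\<close>

lemma mat_inv_index:
  fixes B :: "'a :: field mat"
  assumes B: "B \<in> carrier_mat m m" and inv: "invertible_mat B" and ij: "i < m" "j < m"
  shows "mat_inv B $$ (i, j) = cofactor B j i / det B"
proof -
  note I = mat_inv[OF B inv]
  have nz: "det B \<noteq> 0"
    using inv invertible_mat_iff_det_nonzero[OF B] by simp
  have "adj_mat B = (mat_inv B * B) * adj_mat B"
    using I adj_mat[OF B] by simp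
  also have "\<dots> = mat_inv B * (B * adj_mat B)"
    using I(1) B adj_mat(1)[OF B] by (rule assoc_mult_mat)
  also have "\<dots> = det B \<cdot>\<^sub>m mat_inv B"
    using I(1) by (simp add: adj_mat(2)[OF B] mult_smult_distrib[OF I(1) one_carrier_mat])
  finally have "adj_mat B $$ (i, j) = det B * mat_inv B $$ (i, j)"
    using I(1) ij by simp
  then show ?thesis
    using B ij nz by (simp add: adj_mat_def field_simps)
qed

lemma tendsto_det:
  fixes X :: "nat \<Rightarrow> complex mat"
  assumes X: "\<And>k. X k \<in> carrier_mat m m" and L: "L \<in> carrier_mat m m"
    and lim: "\<And>i j. i < m \<Longrightarrow> j < m \<Longrightarrow> (\<lambda>k. X k $$ (i, j)) \<longlonglongrightarrow> L $$ (i, j)"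
  shows "(\<lambda>k. det (X k)) \<longlonglongrightarrow> det L"
  unfolding det_def'[OF X] det_def'[OF L]
  by (intro tendsto_intros lim) (auto dest: permutes_in_image)

lemma tendsto_cofactor:
  fixes X :: "nat \<Rightarrow> complex mat"
  assumes X: "\<And>k. X k \<in> carrier_mat m m" and L: "L \<in> carrier_mat m m"
    and lim: "\<And>i j. i < m \<Longrightarrow> j < m \<Longrightarrow> (\<lambda>k. X k $$ (i, j)) \<longlonglongrightarrow> L $$ (i, j)"
  shows "(\<lambda>k. cofactor (X k) a b) \<longlonglongrightarrow> cofactor L a b"
  unfolding cofactor_def
proof (intro tendsto_intros tendsto_det)
  show "mat_delete (X k) a b \<in> carrier_mat (m - 1) (m - 1)" for k
    by (rule mat_delete_carrier[OF X])
  show "mat_delete L a b \<in> carrier_mat (m - 1) (m - 1)"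
    by (rule mat_delete_carrier[OF L])
  fix i j assume "i < m - 1" "j < m - 1"
  then show "(\<lambda>k. mat_delete (X k) a b $$ (i, j)) \<longlonglongrightarrow> mat_delete L a b $$ (i, j)"
    using carrier_matD[OF X] carrier_matD[OF L] by (auto simp: mat_delete_def intro!: lim)
qed

lemma lower_right_block_carrier: "lower_right_block r s D \<in> carrier_mat s s"
  by (simp add: lower_right_block_def)

lemma lower_left_block_carrier: "lower_left_block r s D \<in> carrier_mat s r"
  by (simp add: lower_left_block_def)

lemma cf_map_carrier: "cf_defined r s D \<Longrightarrow> cf_map r s D \<in> carrier_mat s r"
  using mat_inv(1)[OF lower_right_block_carrier] lower_left_block_carrier
  unfolding cf_map_def cf_defined_def by (metis mult_carrier_mat)

lemma cf_map_index:
  assumes def: "cf_defined r s D" and ij: "i < s" "j < r"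
  shows "cf_map r s D $$ (i, j) =
    (\<Sum>k<s. cofactor (lower_right_block r s D) k i / det (lower_right_block r s D)
      * lower_left_block r s D $$ (k, j))"
proof -
  have inv: "invertible_mat (lower_right_block r s D)"
    using def by (simp add: cf_defined_def)
  have "cf_map r s D $$ (i, j) =
      (\<Sum>k<s. mat_inv (lower_right_block r s D) $$ (i, k) * lower_left_block r s D $$ (k, j))"
    unfolding cf_map_def
    by (rule index_mult_mat_sum[OF mat_inv(1)[OF lower_right_block_carrier inv]
          lower_left_block_carrier ij])
  also have "\<dots> = (\<Sum>k<s. cofactor (lower_right_block r s D) k i / det (lower_right_block r s D)
      * lower_left_block r s D $$ (k, j))"
    using ij(1) by (intro sum.cong refl) (simp add: mat_inv_index[OF lower_right_block_carrier inv])
  finally show ?thesis .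
qed

text \<open>The determinant of the lower right block depends continuously on the matrix, so it stays
  nonzero near \<open>F\<close>; there the entries of \<open>f\<close> are given by Cramer's rule.\<close>

lemma cf_tendsto_of_entrywise:
  assumes def: "cf_defined r s F"
    and lim: "\<And>i j. i < r + s \<Longrightarrow> j < r + s \<Longrightarrow> (\<lambda>k. X k $$ (i, j)) \<longlonglongrightarrow> F $$ (i, j)"
  shows "cf_tendsto r s X (cf_map r s F)"
proof -
  let ?B = "lower_right_block r s" and ?A = "lower_left_block r s"
  have B: "(\<lambda>k. ?B (X k) $$ (i, j)) \<longlonglongrightarrow> ?B F $$ (i, j)" if "i < s" "j < s" for i j
    using that by (simp add: lower_right_block_def lim)
  have A: "(\<lambda>k. ?A (X k) $$ (i, j)) \<longlonglongrightarrow> ?A F $$ (i, j)" if "i < s" "j < r" for i j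
    using that by (simp add: lower_left_block_def lim)
  have det: "(\<lambda>k. det (?B (X k))) \<longlonglongrightarrow> det (?B F)"
    by (rule tendsto_det[OF lower_right_block_carrier lower_right_block_carrier B])
  have nz: "det (?B F) \<noteq> 0"
    using def by (simp add: cf_defined_def invertible_mat_iff_det_nonzero[OF lower_right_block_carrier])
  have "\<forall>\<^sub>F k in sequentially. det (?B (X k)) \<noteq> 0"
    by (rule tendsto_imp_eventually_ne[OF det nz])
  then have ev: "\<forall>\<^sub>F k in sequentially. cf_defined r s (X k)"
    by (simp add: cf_defined_def invertible_mat_iff_det_nonzero[OF lower_right_block_carrier])
  have "(\<lambda>k. cf_map r s (X k) $$ (i, j)) \<longlonglongrightarrow> cf_map r s F $$ (i, j)" if ij: "i < s" "j < r" for i j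
  proof -
    have "(\<lambda>k. \<Sum>l<s. cofactor (?B (X k)) l i / det (?B (X k)) * ?A (X k) $$ (l, j))
        \<longlonglongrightarrow> (\<Sum>l<s. cofactor (?B F) l i / det (?B F) * ?A F $$ (l, j))"
      using ij
      by (intro tendsto_intros det nz A
          tendsto_cofactor[OF lower_right_block_carrier lower_right_block_carrier B]) auto
    then show ?thesis
      unfolding cf_map_index[OF def ij]
      by (rule Lim_transform_eventually)
        (use ev in eventually_elim, simp add: cf_map_index[OF _ ij])
  qed
  moreover have "\<forall>\<^sub>F k in sequentially. cf_map r s (X k) \<in> carrier_mat s r"
    using ev by eventually_elim (rule cf_map_carrier)
  ultimately show ?thesis
    using ev carrier_matD[OF cf_map_carrier[OF def]] by (simp add: cf_tendsto_def mat_tendsto_def)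
qed

section \<open>Invariance under scaling of rows\<close>

definition row_scaled :: "nat \<Rightarrow> complex mat \<Rightarrow> complex mat \<Rightarrow> bool" where
  "row_scaled n Y X \<longleftrightarrow>
     (\<exists>d. (\<forall>i<n. d i \<noteq> 0) \<and> (\<forall>i<n. \<forall>j<n. Y $$ (i, j) = d i * X $$ (i, j)))"

lemma row_scaled_refl: "row_scaled n X X"
  unfolding row_scaled_def by (rule exI[of _ "\<lambda>_. 1"]) simp

lemma row_scaled_trans:
  assumes "row_scaled n X Y" "row_scaled n Y Z"
  shows "row_scaled n X Z"
proof -
  from assms obtain d d' where
    "\<forall>i<n. d i \<noteq> 0" "\<forall>i<n. \<forall>j<n. X $$ (i, j) = d i * Y $$ (i, j)"
    "\<forall>i<n. d' i \<noteq> 0" "\<forall>i<n. \<forall>j<n. Y $$ (i, j) = d' i * Z $$ (i, j)"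
    unfolding row_scaled_def by blast
  then show ?thesis
    unfolding row_scaled_def by (intro exI[of _ "\<lambda>i. d i * d' i"]) simp
qed

text \<open>A row scaling multiplies both lower blocks on the left by the same invertible diagonal matrix
  \<open>D\<close>, and \<open>(D B)\<^sup>-\<^sup>1 (D A) = B\<^sup>-\<^sup>1 A\<close>.\<close>

lemma cf_map_row_scaled:
  assumes def: "cf_defined r s X" and sc: "row_scaled (r + s) Y X"
  shows "cf_defined r s Y" and "cf_map r s Y = cf_map r s X"
proof -
  let ?B = "lower_right_block r s" and ?A = "lower_left_block r s"
  note carr = lower_right_block_carrier[of r s] lower_left_block_carrier[of r s]
  from sc obtain d where d: "\<And>i. i < r + s \<Longrightarrow> d i \<noteq> 0"
    and Y: "\<And>i j. i < r + s \<Longrightarrow> j < r + s \<Longrightarrow> Y $$ (i, j) = d i * X $$ (i, j)"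
    unfolding row_scaled_def by blast
  define D where "D = mat s s (\<lambda>(i, j). if i = j then d (r + i) else 0)"
  have D: "D \<in> carrier_mat s s"
    by (simp add: D_def)
  have D_mult: "(D * Z) $$ (i, j) = d (r + i) * Z $$ (i, j)"
    if "Z \<in> carrier_mat s m" "i < s" "j < m" for Z m i j
  proof -
    have "(D * Z) $$ (i, j) = (\<Sum>k<s. D $$ (i, k) * Z $$ (k, j))"
      by (rule index_mult_mat_sum[OF D that])
    also have "\<dots> = (\<Sum>k<s. if k = i then d (r + i) * Z $$ (i, j) else 0)"
      using that by (intro sum.cong) (auto simp: D_def)
    finally show ?thesis
      using that by simp
  qed
  have BY: "?B Y = D * ?B X"
    using D_mult[OF carr(1)] D by (intro eq_matI) (auto simp: lower_right_block_def Y)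
  have AY: "?A Y = D * ?A X"
    using D_mult[OF carr(2)] D by (intro eq_matI) (auto simp: lower_left_block_def Y)
  have "det D = (\<Prod>i<s. d (r + i))"
    using D by (subst det_upper_triangular[OF _ D])
      (auto simp: D_def diag_mat_def prod.list_conv_set_nth lessThan_atLeast0)
  then have "det D \<noteq> 0"
    using d by simp
  with def show defY: "cf_defined r s Y"
    unfolding cf_defined_def BY
    by (simp add: invertible_mat_iff_det_nonzero[OF carr(1)] det_mult[OF D carr(1)]
        invertible_mat_iff_det_nonzero[OF mult_carrier_mat[OF D carr(1)]])
  note IX = mat_inv[OF carr(1) def[unfolded cf_defined_def]]
  note IY = mat_inv[OF carr(1) defY[unfolded cf_defined_def]]
  have R: "cf_map r s X \<in> carrier_mat s r"
    by (rule cf_map_carrier[OF def])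
  have "?B X * cf_map r s X = ?A X"
    unfolding cf_map_def
    by (simp add: assoc_mult_mat[OF carr(1) IX(1) carr(2), symmetric] IX(3) left_mult_one_mat[OF carr(2)])
  then have "?A Y = ?B Y * cf_map r s X"
    unfolding AY BY by (simp add: assoc_mult_mat[OF D carr(1) R])
  then have "cf_map r s Y = mat_inv (?B Y) * ?B Y * cf_map r s X"
    unfolding cf_map_def[of r s Y] by (simp add: assoc_mult_mat[OF IY(1) carr(1) R])
  then show "cf_map r s Y = cf_map r s X"
    using IY(2) R by simp
qed

lemma cf_tendsto_row_scaled:
  assumes "cf_tendsto r s X L" and sc: "\<And>k. row_scaled (r + s) (Y k) (X k)"
  shows "cf_tendsto r s Y L"
proof -
  have ev: "\<forall>\<^sub>F k in sequentially. cf_defined r s (X k)"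
    and lim: "mat_tendsto (\<lambda>k. cf_map r s (X k)) L"
    using assms(1) by (auto simp: cf_tendsto_def)
  have evY: "\<forall>\<^sub>F k in sequentially. cf_defined r s (Y k)"
    using ev by eventually_elim (rule cf_map_row_scaled(1)[OF _ sc])
  have eq: "\<forall>\<^sub>F k in sequentially. cf_map r s (Y k) = cf_map r s (X k)"
    using ev by eventually_elim (rule cf_map_row_scaled(2)[OF _ sc])
  have "\<forall>\<^sub>F k in sequentially. cf_map r s (Y k) \<in> carrier_mat (dim_row L) (dim_col L)"
    using eq conjunct1[OF lim[unfolded mat_tendsto_def]] by eventually_elim simp
  moreover have "(\<lambda>k. cf_map r s (Y k) $$ (i, j)) \<longlonglongrightarrow> L $$ (i, j)"
    if "i < dim_row L" "j < dim_col L" for i j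
  proof (rule Lim_transform_eventually)
    show "(\<lambda>k. cf_map r s (X k) $$ (i, j)) \<longlonglongrightarrow> L $$ (i, j)"
      using lim that by (simp add: mat_tendsto_def)
    show "\<forall>\<^sub>F k in sequentially. cf_map r s (X k) $$ (i, j) = cf_map r s (Y k) $$ (i, j)"
      using eq by eventually_elim simp
  qed
  ultimately show ?thesis
    using evY by (simp add: cf_tendsto_def mat_tendsto_def)
qed

lemma row_scaled_pow_mult:
  assumes A: "A \<in> carrier_mat n n" and X: "X \<in> carrier_mat n n"
    and sc: "\<And>Z. Z \<in> carrier_mat n n \<Longrightarrow> row_scaled n (A * Z) Z"
  shows "row_scaled n (A ^\<^sub>m k * X) X"
  using X
proof (induction k arbitrary: X)
  case 0
  then show ?case
    using A by (simp add: row_scaled_refl)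
next
  case (Suc k)
  have "A ^\<^sub>m Suc k * X = A ^\<^sub>m k * (A * X)"
    using A Suc.prems by (simp add: assoc_mult_mat[of _ n n _ n _ n])
  then show ?case
    using Suc.IH[of "A * X"] sc[OF Suc.prems] A Suc.prems
    by (auto intro: row_scaled_trans)
qed

lemma row_scaled_diagonal_mult:
  assumes T: "unimodular_diagonal n T" and X: "X \<in> carrier_mat n n"
  shows "row_scaled n (T * X) X"
  using T monomial_mult_index[OF unimodular_diagonal_imp_monomial[OF T] X]
  unfolding row_scaled_def unimodular_diagonal_def
  by (intro exI[of _ "\<lambda>i. T $$ (i, i)"]) auto

lemma exchange_mat_monomial: "unimodular_monomial n (\<lambda>i. n - 1 - i) (exchange_mat n)"
  by (rule unimodular_antidiagonal_imp_monomial)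
    (auto simp: unimodular_antidiagonal_def antidiagonal_mat_def exchange_mat_def)

lemma exchange_mat_mult_index:
  assumes X: "X \<in> carrier_mat n n" and ij: "i < n" "j < n"
  shows "(exchange_mat n * X) $$ (i, j) = X $$ (n - 1 - i, j)"
  unfolding monomial_mult_index[OF exchange_mat_monomial X ij]
  using ij by (simp add: exchange_mat_def)

text \<open>An antidiagonal matrix is a diagonal one times the exchange matrix.\<close>

lemma row_scaled_antidiagonal_mult:
  assumes T: "unimodular_antidiagonal n T" and X: "X \<in> carrier_mat n n"
  shows "row_scaled n (T * X) (exchange_mat n * X)"
  using T monomial_mult_index[OF unimodular_antidiagonal_imp_monomial[OF T] X]
    exchange_mat_mult_index[OF X]
  unfolding row_scaled_def unimodular_antidiagonal_def
  by (intro exI[of _ "\<lambda>i. T $$ (i, n - 1 - i)"]) auto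

text \<open>Reversing the rows twice restores their order, so the square of an antidiagonal matrix is
  diagonal.\<close>

lemma row_scaled_antidiagonal_square_mult:
  assumes T: "unimodular_antidiagonal n T" and X: "X \<in> carrier_mat n n"
  shows "row_scaled n (T * T * X) X"
proof -
  have Tc: "T \<in> carrier_mat n n" and nz: "\<And>i. i < n \<Longrightarrow> T $$ (i, n - 1 - i) \<noteq> 0"
    using T by (auto simp: unimodular_antidiagonal_def)
  note idx = monomial_mult_index[OF unimodular_antidiagonal_imp_monomial[OF T]]
  have TX: "T * X \<in> carrier_mat n n"
    using Tc X by simp
  have "(T * T * X) $$ (i, j) = T $$ (i, n - 1 - i) * T $$ (n - 1 - i, i) * X $$ (i, j)"
    if "i < n" "j < n" for i j
    using that by (simp add: assoc_mult_mat[OF Tc Tc X] idx[OF TX] idx[OF X])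
  moreover have "T $$ (i, n - 1 - i) * T $$ (n - 1 - i, i) \<noteq> 0" if "i < n" for i
    using nz[OF that] nz[of "n - 1 - i"] that by simp
  ultimately show ?thesis
    unfolding row_scaled_def by (intro exI[of _ "\<lambda>i. T $$ (i, n - 1 - i) * T $$ (n - 1 - i, i)"]) blast
qed

lemma pow_mat_double:
  assumes A: "(A :: 'a :: semiring_1 mat) \<in> carrier_mat n n"
  shows "A ^\<^sub>m (2 * k) = (A * A) ^\<^sub>m k"
  using A by (induction k) (auto simp: assoc_mult_mat[of _ n n _ n _ n])

section \<open>Convergence of the approximants\<close>

theorem theorem12:
  fixes r s n :: nat
    and N :: "complex mat \<Rightarrow> real"
    and \<theta> :: "nat \<Rightarrow> complex mat"
    and T :: "complex mat"
  assumes "r > 0" and "s > 0" and "r + s = n"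
    and "norm_on_mats n N"
    and "\<And>k. k \<ge> 1 \<Longrightarrow> \<theta> k \<in> carrier_mat n n"
    and "unimodular_diagonal n T \<or> unimodular_antidiagonal n T"
    and "summable (\<lambda>k. N (\<theta> (Suc k) - T))"
  shows "(\<exists>F. mat_tendsto (\<lambda>k. mat_inv T ^\<^sub>m k * left_prod n \<theta> k) F) \<and>
    (\<forall>F. mat_tendsto (\<lambda>k. mat_inv T ^\<^sub>m k * left_prod n \<theta> k) F \<longrightarrow>
      invertible_mat (lower_right_block r s F) \<longrightarrow>
      (unimodular_diagonal n T \<longrightarrow>
        cf_tendsto r s (\<lambda>k. left_prod n \<theta> k) (cf_map r s F)) \<and>
      (unimodular_antidiagonal n T \<longrightarrow>
        cf_tendsto r s (\<lambda>k. left_prod n \<theta> (2 * k)) (cf_map r s F) \<and>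
        (cf_defined r s (exchange_mat n * F) \<longrightarrow>
          cf_tendsto r s (\<lambda>k. left_prod n \<theta> (2 * k + 1)) (cf_map r s (exchange_mat n * F)))))"
proof -
  obtain \<sigma> where mono: "unimodular_monomial n \<sigma> T"
    using assms(6) unimodular_diagonal_imp_monomial unimodular_antidiagonal_imp_monomial by blast
  note Tc = monomial_carrier[OF mono]
  let ?L = "left_prod n \<theta>"
  define P where "P k = mat_inv T ^\<^sub>m k * ?L k" for k
  have L: "?L k \<in> carrier_mat n n" for k
    by (rule left_prod_carrier[OF assms(5)])
  have Sk: "mat_inv T ^\<^sub>m k \<in> carrier_mat n n" for k
    using mat_inv_monomial(1)[OF mono] by simp
  have P: "P k \<in> carrier_mat n n" for k
    unfolding P_def by (rule mult_carrier_mat[OF Sk L])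
  have L_eq: "?L k = T ^\<^sub>m k * P k" for k
    using L[of k] monomial_pow_mat_inv_pow[OF mono, of k]
    by (simp add: P_def assoc_mult_mat[OF pow_carrier_mat[OF Tc] Sk L, symmetric])

  obtain c where c: "\<And>A. A \<in> carrier_mat n n \<Longrightarrow> entry_sum n A \<le> c * N A"
    using entry_sum_le_norm_on_mats[OF assms(4)] by blast
  have "summable (\<lambda>k. entry_sum n (\<theta> (Suc k) - T))"
  proof (rule summable_comparison_test')
    show "summable (\<lambda>k. c * N (\<theta> (Suc k) - T))"
      by (rule summable_mult[OF assms(7)])
    show "norm (entry_sum n (\<theta> (Suc k) - T)) \<le> c * N (\<theta> (Suc k) - T)" for k
      using c[OF minus_carrier_mat[OF Tc]] entry_sum_nonneg by simp
  qed
  then have ex: "\<exists>F. mat_tendsto P F"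
    using untwisted_product_converges[OF mono assms(5)] by (simp add: P_def[abs_def])

  have approx: "(unimodular_diagonal n T \<longrightarrow> cf_tendsto r s ?L (cf_map r s F)) \<and>
      (unimodular_antidiagonal n T \<longrightarrow>
        cf_tendsto r s (\<lambda>k. ?L (2 * k)) (cf_map r s F) \<and>
        (cf_defined r s (exchange_mat n * F) \<longrightarrow>
          cf_tendsto r s (\<lambda>k. ?L (2 * k + 1)) (cf_map r s (exchange_mat n * F))))"
    if lim: "mat_tendsto P F" and inv: "invertible_mat (lower_right_block r s F)" for F
  proof -
    have F: "F \<in> carrier_mat n n"
    proof -
      obtain k where "P k \<in> carrier_mat (dim_row F) (dim_col F)"
        using lim by (auto simp: mat_tendsto_def eventually_sequentially)
      then show ?thesis
        using P[of k] by (metis carrier_matD carrier_matI)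
    qed
    have entry: "(\<lambda>k. P k $$ (i, j)) \<longlonglongrightarrow> F $$ (i, j)" if "i < n" "j < n" for i j
      using lim F that by (auto simp: mat_tendsto_def)
    have def: "cf_defined r s F"
      using inv by (simp add: cf_defined_def)
    have even: "strict_mono (\<lambda>k :: nat. 2 * k)" and odd: "strict_mono (\<lambda>k :: nat. 2 * k + 1)"
      by (auto simp: strict_mono_def)
    have diag: "cf_tendsto r s ?L (cf_map r s F)" if T: "unimodular_diagonal n T"
    proof (rule cf_tendsto_row_scaled)
      show "cf_tendsto r s P (cf_map r s F)"
        using cf_tendsto_of_entrywise[OF def] entry assms(3) by simp
      show "row_scaled (r + s) (?L k) (P k)" for k
        unfolding L_eq[of k] assms(3)
        by (rule row_scaled_pow_mult[OF Tc P row_scaled_diagonal_mult[OF T]])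
    qed
    have scaled: "row_scaled n (T ^\<^sub>m (2 * k) * X) X"
      if "unimodular_antidiagonal n T" "X \<in> carrier_mat n n" for k X
      unfolding pow_mat_double[OF Tc]
      using Tc row_scaled_antidiagonal_square_mult[OF that(1)] that(2)
      by (intro row_scaled_pow_mult) auto
    have anti_even: "cf_tendsto r s (\<lambda>k. ?L (2 * k)) (cf_map r s F)"
      if T: "unimodular_antidiagonal n T"
    proof (rule cf_tendsto_row_scaled)
      show "cf_tendsto r s (\<lambda>k. P (2 * k)) (cf_map r s F)"
        using LIMSEQ_subseq_LIMSEQ[OF entry even] assms(3)
        by (intro cf_tendsto_of_entrywise[OF def]) (simp add: o_def)
      show "row_scaled (r + s) (?L (2 * k)) (P (2 * k))" for k
        unfolding L_eq[of "2 * k"] assms(3) by (rule scaled[OF T P])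
    qed
    have anti_odd: "cf_tendsto r s (\<lambda>k. ?L (2 * k + 1)) (cf_map r s (exchange_mat n * F))"
      if T: "unimodular_antidiagonal n T" and defJ: "cf_defined r s (exchange_mat n * F)"
    proof (rule cf_tendsto_row_scaled)
      show "cf_tendsto r s (\<lambda>k. exchange_mat n * P (2 * k + 1)) (cf_map r s (exchange_mat n * F))"
      proof (rule cf_tendsto_of_entrywise[OF defJ])
        fix i j assume "i < r + s" "j < r + s"
        then have ij: "i < n" "j < n"
          using assms(3) by auto
        then show "(\<lambda>k. (exchange_mat n * P (2 * k + 1)) $$ (i, j))
            \<longlonglongrightarrow> (exchange_mat n * F) $$ (i, j)"
          using LIMSEQ_subseq_LIMSEQ[OF entry odd, of "n - 1 - i" j]
          by (simp add: exchange_mat_mult_index[OF P] exchange_mat_mult_index[OF F] o_def)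
      qed
      show "row_scaled (r + s) (?L (2 * k + 1)) (exchange_mat n * P (2 * k + 1))" for k
      proof -
        \<comment> \<open>The even power \<open>T\<^sup>2\<^sup>k\<close> only scales rows; the one remaining factor \<open>T\<close> supplies \<open>J\<close>.\<close>
        have "?L (2 * k + 1) = T ^\<^sub>m (2 * k) * (T * P (2 * k + 1))"
          using L_eq[of "2 * k + 1"]
            assoc_mult_mat[OF pow_carrier_mat[OF Tc] Tc P, of "2 * k" "2 * k + 1"] by simp
        then show ?thesis
          using scaled[OF T, of "T * P (2 * k + 1)"] row_scaled_antidiagonal_mult[OF T P] Tc P
            assms(3) by (metis mult_carrier_mat row_scaled_trans)
      qed
    qed
    show ?thesis
      using diag anti_even anti_odd by blast
  qed
  show ?thesis
    using ex approx unfolding P_def by blast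
qed

end
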